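(* Let $\alpha\in(0,1)$, let $k>0$ be a time step, $t_n=nk$, and let $\mathcal{D}^\alpha$ be the discrete Caputo derivative $$(\mathcal{D}^\alpha X)_n=k^{-\alpha}\Big(c_0X_n-\sum_{i=1}^{n-1}c_iX_{n-i}-c_n^nX_0\Big),\quad n\ge1.$$ Let $u=\{u_n\}_{n\ge0}$, $v=\{v_n\}_{n\ge0}$, $w=\{w_n\}_{n\ge0}$ be three real sequences with $u_0\le v_0\le w_0$, and let $f=f(s,x)$ be a real-valued function of $s\ge0$, $x\in\mathbb{R}$. (1) (Convex functional) Suppose $E:\mathbb{R}^d\to\mathbb{R}$ is convex (and differentiable), and let $X=\{X_n\}_{n\ge0}$ be any sequence in $\mathbb{R}^d$. Then for all $n\ge1$ $$(\mathcal{D}^\alpha E(X))_n\le(\mathcal{D}^\alpha X)_n\cdot\nabla E(X_n),$$ where $E(X)$ denotes the sequence $\{E(X_n)\}$. (2) (Comparison for nonincreasing $f$) Suppose $f(s,\cdot)$ is non-increasing for each $s$, and for all $n\ge1$ $$(\mathcal{D}^\alpha u)_n\le f(t_n,u_n),\quad(\mathcal{D}^\alpha v)_n=f(t_n,v_n),\quad(\mathcal{D}^\alpha w)_n\ge f(t_n,w_n).$$ Then $u_n\le v_n\le w_n$ for all $n$. (3) (Comparison for Lipschitz $f$) Suppose $f$ is Lipschitz continuous in its second variable with Lipschitz constant $L$, and for all $n\ge1$ $$(\mathcal{D}^\alpha u)_n\le f(t_n,u_n),\quad(\mathcal{D}^\alpha v)_n=f(t_n,v_n),\quad(\mathcal{D}^\alpha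 w)_n\ge f(t_n,w_n).$$ If the step size satisfies $c_0>k^\alpha L$, then $u_n\le v_n\le w_n$ for all $n$. (4) (Comparison for the integral form) Suppose $f(s,\cdot)$ is non-decreasing for each $s$ and Lipschitz continuous in the second variable with Lipschitz constant $L$. Put $f_u=(0,f(t_1,u_1),f(t_2,u_2),\ldots)$ and define $f_v,f_w$ similarly. If for all $n\ge1$ $$u_n\le u_0+(J_kf_u)_n,\quad v_n=v_0+(J_kf_v)_n,\quad w_n\ge w_0+(J_kf_w)_n,$$ and the step size satisfies $k^\alpha a_0L=k^\alpha L/c_0<1$, then $u_n\le v_n\le w_n$ for all $n$.
   Context: The coefficients are defined as follows. $a_n=\frac{(n+1)^\alpha-n^\alpha}{\Gamma(1+\alpha)}$ for $n\ge0$; $a^{(-1)}$ is the convolution inverse of $a$, i.e. $a*a^{(-1)}=(1,0,0,\ldots)$ where $(p*q)_n=\sum_{m=0}^np_mq_{n-m}$; $c_0=a^{(-1)}_0=\Gamma(1+\alpha)$, $c_i=-a_i^{(-1)}$ for $i\ge1$, and $c_n^n=c_0-\sum_{i=1}^{n-1}c_i$ for $n\ge1$. Equivalently $(\mathcal{D}^\alpha X)_n=k^{-\alpha}(a^{(-1)}*(X-X_0))_n$. The discrete fractional integral is $(J_kF)_n=k^\alpha\sum_{m=1}^na_{n-m}F_m$. *)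

theory Defs
  imports "HOL-Analysis.Analysis"
begin

definition conv :: "(nat \<Rightarrow> real) \<Rightarrow> (nat \<Rightarrow> real) \<Rightarrow> nat \<Rightarrow> real" where
  "conv p q n = (\<Sum>m=0..n. p m * q (n - m))"

definition conv_inverse :: "(nat \<Rightarrow> real) \<Rightarrow> nat \<Rightarrow> real" where
  "conv_inverse p = (THE q. conv p q = (\<lambda>n. if n = 0 then 1 else 0))"

lemma conv_eq_fps: "conv p q = fps_nth (Abs_fps p * Abs_fps q)"
  by (rule ext) (simp add: conv_def fps_mult_nth)

lemma conv_delta_iff:
  assumes "p 0 \<noteq> 0"
  shows "conv p q = (\<lambda>n. if n = 0 then 1 else 0) \<longleftrightarrow> q = fps_nth (inverse (Abs_fps p))"
proof -
  have nz: "fps_nth (Abs_fps p) 0 \<noteq> 0" using assms by simp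
  have "conv p q = (\<lambda>n. if n = 0 then 1 else 0) \<longleftrightarrow> Abs_fps p * Abs_fps q = 1"
    by (simp add: conv_eq_fps fps_eq_iff fun_eq_iff)
  also have "\<dots> \<longleftrightarrow> Abs_fps q = inverse (Abs_fps p)"
    using fps_inverse_unique inverse_mult_eq_1'[OF nz] by metis
  also have "\<dots> \<longleftrightarrow> q = fps_nth (inverse (Abs_fps p))"
    by (simp add: fps_eq_iff fun_eq_iff)
  finally show ?thesis .
qed

lemma conv_inverse_fps:
  "p 0 \<noteq> 0 \<Longrightarrow> conv_inverse p = fps_nth (inverse (Abs_fps p))"
  unfolding conv_inverse_def by (simp add: conv_delta_iff)

lemma conv_conv_inverse:
  "p 0 \<noteq> 0 \<Longrightarrow> conv p (conv_inverse p) = (\<lambda>n. if n = 0 then 1 else 0)"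
  by (simp add: conv_delta_iff conv_inverse_fps)

text \<open>For \<open>n = 0\<close> the term \<open>n\<^sup>\<alpha>\<close> is \<open>0 powr \<alpha> = 0\<close>, as intended for \<open>\<alpha> > 0\<close>.\<close>

definition acoef :: "real \<Rightarrow> nat \<Rightarrow> real" where
  "acoef \<alpha> n = ((real n + 1) powr \<alpha> - real n powr \<alpha>) / Gamma (1 + \<alpha>)"

definition ccoef :: "real \<Rightarrow> nat \<Rightarrow> real" where
  "ccoef \<alpha> i = (if i = 0 then conv_inverse (acoef \<alpha>) 0 else - conv_inverse (acoef \<alpha>) i)"

text \<open>The diagonal coefficient \<open>c\<^sub>n\<^sup>n\<close>, for \<open>n \<ge> 1\<close>.\<close>

definition ccoef_diag :: "real \<Rightarrow> nat \<Rightarrow> real" where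
  "ccoef_diag \<alpha> n = ccoef \<alpha> 0 - (\<Sum>i=1..n-1. ccoef \<alpha> i)"

definition caputo :: "real \<Rightarrow> real \<Rightarrow> (nat \<Rightarrow> 'a::real_vector) \<Rightarrow> nat \<Rightarrow> 'a" where
  "caputo \<alpha> k X n = k powr (-\<alpha>) *\<^sub>R
     (ccoef \<alpha> 0 *\<^sub>R X n - (\<Sum>i=1..n-1. ccoef \<alpha> i *\<^sub>R X (n - i)) - ccoef_diag \<alpha> n *\<^sub>R X 0)"

definition frac_integral :: "real \<Rightarrow> real \<Rightarrow> (nat \<Rightarrow> real) \<Rightarrow> nat \<Rightarrow> real" where
  "frac_integral \<alpha> k F n = k powr \<alpha> * (\<Sum>m=1..n. acoef \<alpha> (n - m) * F m)"

definition rhs_seq :: "(real \<Rightarrow> real \<Rightarrow> real) \<Rightarrow> real \<Rightarrow> (nat \<Rightarrow> real) \<Rightarrow> nat \<Rightarrow> real" where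
  "rhs_seq f k u n = (if n = 0 then 0 else f (real n * k) (u n))"

definition grad :: "('a::euclidean_space \<Rightarrow> real) \<Rightarrow> 'a \<Rightarrow> 'a" where
  "grad E x = (THE D. GDERIV E x :> D)"

lemma GDERIV_grad:
  assumes "E differentiable (at x)"
  shows "GDERIV E x :> grad E x"
proof -
  obtain E' where E': "(E has_derivative E') (at x)"
    using assms by (auto simp: differentiable_def)
  interpret E': linear E' using E' by (rule has_derivative_linear)
  define D where "D = (\<Sum>b\<in>Basis. E' b *\<^sub>R b)"
  have "E' h = h \<bullet> D" for h
  proof -
    have "E' h = E' (\<Sum>b\<in>Basis. (h \<bullet> b) *\<^sub>R b)" by (simp add: euclidean_representation)
    also have "\<dots> = (\<Sum>b\<in>Basis. (h \<bullet> b) * E' b)" by (simp add: E'.sum E'.scaleR)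
    finally show ?thesis by (simp add: D_def inner_sum_right mult.commute)
  qed
  hence "E' = (\<lambda>h. h \<bullet> D)" by auto
  hence D: "GDERIV E x :> D" using E' by (simp add: gderiv_def)
  have "D2 = D" if "GDERIV E x :> D2" for D2
  proof -
    have "(\<lambda>h. h \<bullet> D2) = (\<lambda>h. h \<bullet> D)"
      using that D unfolding gderiv_def by (rule has_derivative_unique)
    hence "\<forall>h. h \<bullet> D2 = h \<bullet> D" by (simp add: fun_eq_iff)
    thus ?thesis by (simp only: vector_eq_ldot)
  qed
  thus ?thesis unfolding grad_def using D by (rule theI[rotated])
qed

lemma acoef_0: "acoef \<alpha> 0 = 1 / Gamma (1 + \<alpha>)"
  by (simp add: acoef_def)

lemma ccoef_0:
  assumes "0 < \<alpha>"
  shows "ccoef \<alpha> 0 = Gamma (1 + \<alpha>)" and "ccoef \<alpha> 0 = 1 / acoef \<alpha> 0"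
proof -
  have "Gamma (1 + \<alpha>) > 0" using assms by (intro Gamma_real_pos) simp
  thus "ccoef \<alpha> 0 = Gamma (1 + \<alpha>)" "ccoef \<alpha> 0 = 1 / acoef \<alpha> 0"
    by (simp_all add: ccoef_def conv_inverse_fps acoef_0 field_simps)
qed

lemma caputo_conv:
  fixes X :: "nat \<Rightarrow> real"
  assumes "n \<ge> 1"
  shows "caputo \<alpha> k X n = k powr (-\<alpha>) * conv (conv_inverse (acoef \<alpha>)) (\<lambda>m. X m - X 0) n"
proof -
  let ?b = "conv_inverse (acoef \<alpha>)"
  have n: "{0..n} = insert 0 (insert n {1..n-1})" using assms by auto
  have "conv ?b (\<lambda>m. X m - X 0) n
      = ?b 0 * (X n - X 0) + (\<Sum>i=1..n-1. ?b i * (X (n - i) - X 0))"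
    unfolding conv_def n using assms by (subst sum.insert; simp)+
  also have "(\<Sum>i=1..n-1. ?b i * (X (n - i) - X 0))
      = - (\<Sum>i=1..n-1. ccoef \<alpha> i * X (n - i)) + (\<Sum>i=1..n-1. ccoef \<alpha> i) * X 0"
    unfolding sum_distrib_right sum_negf[symmetric] sum.distrib[symmetric]
    by (rule sum.cong) (auto simp: ccoef_def algebra_simps)
  finally have eq: "conv ?b (\<lambda>m. X m - X 0) n
      = ccoef \<alpha> 0 * X n - (\<Sum>i=1..n-1. ccoef \<alpha> i * X (n - i)) - ccoef_diag \<alpha> n * X 0"
    by (simp add: ccoef_diag_def ccoef_def[of \<alpha> 0] algebra_simps)
  show ?thesis unfolding eq caputo_def real_scaleR_def ..
qed

end

theory Submission
  imports Defs
begin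

text \<open>
  The weights \<open>a\<^sub>n\<close> are positive, decreasing and log-convex, so by Kaluza's theorem
  the convolution inverse is nonpositive away from \<open>0\<close>, and its partial sums are
  nonnegative: all the coefficients \<open>c\<^sub>i\<close> and \<open>c\<^sub>n\<^sup>n\<close> are nonnegative.
  Hence the discrete Caputo derivative is a nonnegative combination of the backward
  differences \<open>X\<^sub>n - X\<^sub>m\<close>. The convexity inequality is then the tangent
  inequality applied termwise. In each comparison statement one looks at the first index at
  which the difference of the two sequences is positive: the memory terms have the right
  sign, and the hypothesis on \<open>f\<close> or on the step size rules out the diagonal term.
\<close>

section \<open>Sign of the convolution inverse of a positive log-convex sequence\<close>

lemma log_convex_ratio_mono:
  fixes a :: "nat \<Rightarrow> real"
  assumes pos: "\<And>n. a n > 0" and lc: "\<And>n. (a (Suc n))\<^sup>2 \<le> a n * a (Suc (Suc n))"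
    and "m \<le> n"
  shows "a (Suc m) / a m \<le> a (Suc n) / a n"
proof -
  have "a (Suc n) / a n \<le> a (Suc (Suc n)) / a (Suc n)" for n
    using lc[of n] pos[of n] pos[of "Suc n"] by (simp add: field_simps power2_eq_square)
  then show ?thesis
    using \<open>m \<le> n\<close> by (rule lift_Suc_mono_le[of "\<lambda>n. a (Suc n) / a n"])
qed

text \<open>This is coefficient \<open>n\<close> of \<open>conv a (conv_inverse a)\<close>, which is
  zero for \<open>n \<ge> 1\<close>, with the \<open>i = 0\<close> term moved to the right. The
  minus signs anticipate the log-convex case, where the weights \<open>- conv_inverse a i\<close>
  are nonnegative.\<close>

lemma conv_inverse_recurrence:
  assumes "a 0 \<noteq> 0" "n \<ge> 1"
  shows "(\<Sum>i=1..n. - conv_inverse a i * a (n - i)) = a n * conv_inverse a 0"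
proof -
  have "0 = (\<Sum>m=0..n. a m * conv_inverse a (n - m))"
    using conv_conv_inverse[of a, OF assms(1)] assms(2) by (auto simp: conv_def fun_eq_iff)
  also have "\<dots> = (\<Sum>i=0..n. a (n - i) * conv_inverse a i)"
    by (rule sum.reindex_bij_witness[of _ "\<lambda>i. n - i" "\<lambda>i. n - i"]) auto
  also have "\<dots> = a n * conv_inverse a 0 + (\<Sum>i=1..n. a (n - i) * conv_inverse a i)"
    by (simp add: sum.atLeast_Suc_atMost)
  finally show ?thesis by (simp add: sum_negf mult.commute)
qed

text \<open>The recurrences at \<open>n - 1\<close> and \<open>n\<close> are compared. Nondecreasing
  ratios give \<open>a (n - i) \<le> a n / a (n - 1) * a (n - 1 - i)\<close>, so by induction the
  earlier terms contribute at most \<open>a n * conv_inverse a 0\<close>, leaving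
  \<open>- conv_inverse a n * a 0 \<ge> 0\<close>.\<close>

lemma Kaluza:
  fixes a :: "nat \<Rightarrow> real"
  assumes pos: "\<And>n. a n > 0" and lc: "\<And>n. (a (Suc n))\<^sup>2 \<le> a n * a (Suc (Suc n))"
    and "n \<ge> 1"
  shows "conv_inverse a n \<le> 0"
  using \<open>n \<ge> 1\<close>
proof (induction n rule: less_induct)
  case (less n)
  let ?b = "conv_inverse a"
  have a0: "a 0 \<noteq> 0" using pos[of 0] by simp
  obtain j where n: "n = Suc j" using less.prems by (cases n) auto
  have b0: "?b 0 > 0" using pos[of 0] a0 by (simp add: conv_inverse_fps)
  have rec: "(\<Sum>i=1..j. - ?b i * a (Suc j - i)) - ?b n * a 0 = a n * ?b 0"
    using conv_inverse_recurrence[of a, OF a0 less.prems] by (simp add: n)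
  have "(\<Sum>i=1..j. - ?b i * a (Suc j - i)) \<le> a n * ?b 0"
  \<comment> \<open>The recurrence at \<open>j\<close> is available only for
    \<open>j \<ge> 1\<close>; at \<open>j = 0\<close> the sum is empty.\<close>
  proof (cases "j = 0")
    case True
    then show ?thesis using b0 pos[of n] by simp
  next
    case False
    have "(\<Sum>i=1..j. - ?b i * a (Suc j - i)) \<le> (\<Sum>i=1..j. - ?b i * (a (Suc j) / a j * a (j - i)))"
    proof (intro sum_mono mult_left_mono)
      fix i assume i: "i \<in> {1..j}"
      have "a (Suc (j - i)) / a (j - i) \<le> a (Suc j) / a j"
        by (rule log_convex_ratio_mono[of a, OF pos lc]) auto
      then show "a (Suc j - i) \<le> a (Suc j) / a j * a (j - i)"
        using i pos[of "j - i"] by (simp add: pos_divide_le_eq Suc_diff_le)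
      show "0 \<le> - ?b i" using less.IH[of i] i n by auto
    qed
    also have "\<dots> = a (Suc j) / a j * (\<Sum>i=1..j. - ?b i * a (j - i))"
      unfolding sum_distrib_left by (rule sum.cong) auto
    also have "\<dots> = a n * ?b 0"
      using conv_inverse_recurrence[of a j, OF a0] False pos[of j] by (simp add: n)
    finally show ?thesis .
  qed
  with rec have "?b n * a 0 \<le> 0" by linarith
  then show ?case using pos[of 0] by (simp add: mult_le_0_iff not_less)
qed

text \<open>Since \<open>a n \<le> a (n - i)\<close>, replacing \<open>a (n - i)\<close> by
  \<open>a n\<close> in the recurrence can only lower its nonnegative terms; then \<open>a n\<close>
  cancels.\<close>

lemma conv_inverse_partial_sum_nonneg:
  fixes a :: "nat \<Rightarrow> real"
  assumes pos: "\<And>n. a n > 0" and lc: "\<And>n. (a (Suc n))\<^sup>2 \<le> a n * a (Suc (Suc n))"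
    and dec: "decseq a"
  shows "(\<Sum>i=1..n. - conv_inverse a i) \<le> conv_inverse a 0"
proof (cases "n = 0")
  case True
  then show ?thesis using pos[of 0] by (simp add: conv_inverse_fps)
next
  case False
  have a0: "a 0 \<noteq> 0" using pos[of 0] by simp
  have "a n * (\<Sum>i=1..n. - conv_inverse a i) = (\<Sum>i=1..n. - conv_inverse a i * a n)"
    by (simp add: sum_distrib_left mult.commute)
  also have "\<dots> \<le> (\<Sum>i=1..n. - conv_inverse a i * a (n - i))"
    using Kaluza[of a, OF pos lc] decseqD[OF dec] by (intro sum_mono mult_left_mono) auto
  also have "\<dots> = a n * conv_inverse a 0"
    using conv_inverse_recurrence[of a n, OF a0] False by simp
  finally show ?thesis using pos[of n] by simp
qed

section \<open>Positivity, log-convexity and decrease of the weights\<close>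

text \<open>The weights \<open>acoef\<close> without their Gamma factor, extended to a real argument
  so that calculus applies; differentiation keeps the form and lowers the exponent by one.\<close>

definition powr_increment :: "real \<Rightarrow> real \<Rightarrow> real" where
  "powr_increment \<alpha> x = (x + 1) powr \<alpha> - x powr \<alpha>"

lemma powr_increment_pos: "0 < \<alpha> \<Longrightarrow> 0 \<le> x \<Longrightarrow> powr_increment \<alpha> x > 0"
  by (simp add: powr_increment_def powr_less_mono2)

lemma powr_increment_has_real_derivative:
  assumes "x > 0"
  shows "(powr_increment \<alpha> has_real_derivative \<alpha> * powr_increment (\<alpha> - 1) x) (at x)"
  unfolding powr_increment_def[abs_def] using assms
  by (auto intro!: derivative_eq_intros simp: algebra_simps)

lemma continuous_on_powr_increment:
  assumes "0 < \<alpha>"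
  shows "continuous_on {0..} (powr_increment \<alpha>)"
  unfolding powr_increment_def[abs_def] using assms
  by (intro continuous_intros continuous_on_powr') auto

lemma powr_increment_log_derivative:
  assumes "0 < \<alpha>" "0 < x"
  obtains \<xi> where "x < \<xi>" "\<xi> < x + 1"
    "\<alpha> * powr_increment (\<alpha> - 1) x / powr_increment \<alpha> x = (\<alpha> - 1) / \<xi>"
proof -
  have "\<exists>c. x < c \<and> c < x + 1 \<and>
      ((x + 1) powr (\<alpha> - 1) - x powr (\<alpha> - 1)) * (\<alpha> * c powr (\<alpha> - 1))
        = ((x + 1) powr \<alpha> - x powr \<alpha>) * ((\<alpha> - 1) * c powr (\<alpha> - 1 - 1))"
    using assms by (intro GMVT') (auto intro!: derivative_eq_intros continuous_intros)
  then obtain c where c: "x < c" "c < x + 1" and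
    "powr_increment (\<alpha> - 1) x * (\<alpha> * c powr (\<alpha> - 1))
        = powr_increment \<alpha> x * ((\<alpha> - 1) * c powr (\<alpha> - 1 - 1))"
    by (auto simp: powr_increment_def)
  \<comment> \<open>This exposes \<open>c powr (\<alpha> - 1 - 1)\<close> as a common nonzero factor
    of the Cauchy identity.\<close>
  moreover have "c powr (\<alpha> - 1) = c * c powr (\<alpha> - 1 - 1)"
    using c assms by (simp add: powr_mult_base)
  ultimately have "c powr (\<alpha> - 1 - 1) * (\<alpha> * powr_increment (\<alpha> - 1) x * c)
      = c powr (\<alpha> - 1 - 1) * ((\<alpha> - 1) * powr_increment \<alpha> x)"
    by (simp only: mult_ac)
  then have "\<alpha> * powr_increment (\<alpha> - 1) x * c = (\<alpha> - 1) * powr_increment \<alpha> x"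
    using c assms by simp
  then show ?thesis
    using c that[of c] powr_increment_pos[of \<alpha> x] assms by (simp add: frac_eq_eq)
qed

text \<open>
  By Cauchy's mean value theorem the logarithmic derivative at \<open>x\<close> is
  \<open>(\<alpha> - 1) / \<xi>\<close> with \<open>\<xi>\<close> between \<open>x\<close> and \<open>x + 1\<close>, so it grows under the shift
  \<open>x \<mapsto> x + 1\<close>. Continuity up to the left end point covers \<open>x = 0\<close>, where \<open>x powr \<alpha>\<close> is
  not differentiable.
\<close>

lemma powr_increment_log_convex:
  assumes "0 < \<alpha>" "\<alpha> < 1" "0 \<le> x"
  shows "(powr_increment \<alpha> (x + 1))\<^sup>2 \<le> powr_increment \<alpha> x * powr_increment \<alpha> (x + 2)"
proof -
  let ?D = "powr_increment \<alpha>"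
  let ?q = "\<lambda>y. ln (?D (y + 1)) - ln (?D y)"
  \<comment> \<open>\<open>?q\<close> is the logarithm of the ratio of consecutive increments; its
    growth from \<open>x\<close> to \<open>x + 1\<close> becomes log-convexity after
    exponentiation.\<close>
  have "?q x < ?q (x + 1)"
  proof (rule DERIV_pos_imp_increasing_open[of x "x + 1" ?q])
    show "x < x + 1" by simp
    show "continuous_on {x..x + 1} ?q"
    proof (intro continuous_on_diff continuous_on_ln)
      show "continuous_on {x..x + 1} ?D"
        using assms(3) by (intro continuous_on_subset[OF continuous_on_powr_increment[OF assms(1)]]) auto
      show "continuous_on {x..x + 1} (\<lambda>y. ?D (y + 1))"
        by (rule continuous_on_compose2[OF continuous_on_powr_increment[OF assms(1)]])
          (use assms(3) in \<open>auto intro: continuous_intros\<close>)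
      have "?D y > 0 \<and> ?D (y + 1) > 0" if "y \<in> {x..x + 1}" for y
        using that assms(1,3) by (auto intro!: powr_increment_pos)
      then show "\<forall>y\<in>{x..x + 1}. ?D y \<noteq> 0" "\<forall>y\<in>{x..x + 1}. ?D (y + 1) \<noteq> 0"
        by (force dest: less_imp_neq)+
    qed
    fix y assume "x < y" "y < x + 1"
    then have y: "y > 0" using assms by simp
    obtain \<xi> where \<xi>: "y < \<xi>" "\<xi> < y + 1" "\<alpha> * powr_increment (\<alpha> - 1) y / ?D y = (\<alpha> - 1) / \<xi>"
      using powr_increment_log_derivative assms(1) y by blast
    obtain \<eta> where \<eta>: "y + 1 < \<eta>"
        "\<alpha> * powr_increment (\<alpha> - 1) (y + 1) / ?D (y + 1) = (\<alpha> - 1) / \<eta>"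
      using powr_increment_log_derivative[of \<alpha> "y + 1"] assms(1) y by auto
    have 1: "((\<lambda>z. ?D (z + 1)) has_real_derivative \<alpha> * powr_increment (\<alpha> - 1) (y + 1)) (at y)"
      using powr_increment_has_real_derivative[of "y + 1" \<alpha>] y by (simp add: DERIV_shift)
    have "(?q has_real_derivative (\<alpha> - 1) / \<eta> - (\<alpha> - 1) / \<xi>) (at y)"
      unfolding \<xi>(3)[symmetric] \<eta>(2)[symmetric]
      using powr_increment_pos[of \<alpha> y] powr_increment_pos[of \<alpha> "y + 1"] assms(1) y
      by (auto intro!: derivative_eq_intros 1 powr_increment_has_real_derivative[OF y] simp: field_simps)
    \<comment> \<open>The intermediate points satisfy \<open>\<xi> < y + 1 < \<eta>\<close>; passing
      to the negative numerator \<open>\<alpha> - 1\<close> reverses the inequality.\<close>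
    moreover have "(1 - \<alpha>) / \<eta> < (1 - \<alpha>) / \<xi>"
      using \<xi> \<eta> y assms by (intro divide_strict_left_mono) auto
    then have "(\<alpha> - 1) / \<eta> - (\<alpha> - 1) / \<xi> > 0"
      by (simp add: diff_divide_distrib)
    ultimately show "\<exists>l. (?q has_real_derivative l) (at y) \<and> 0 < l" by blast
  qed
  moreover have pos: "?D x > 0" "?D (x + 1) > 0" "?D (x + 2) > 0"
    using assms by (auto intro: powr_increment_pos)
  ultimately have "ln ((?D (x + 1))\<^sup>2) \<le> ln (?D x * ?D (x + 2))"
    by (simp add: ln_mult ln_realpow add.assoc)
  then show ?thesis using pos by simp
qed

lemma acoef_eq_powr_increment: "acoef \<alpha> n = powr_increment \<alpha> (real n) / Gamma (1 + \<alpha>)"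
  by (simp add: acoef_def powr_increment_def)

lemma acoef_pos: "0 < \<alpha> \<Longrightarrow> acoef \<alpha> n > 0"
  by (simp add: acoef_eq_powr_increment powr_increment_pos Gamma_real_pos)

lemma acoef_log_convex:
  assumes "0 < \<alpha>" "\<alpha> < 1"
  shows "(acoef \<alpha> (Suc n))\<^sup>2 \<le> acoef \<alpha> n * acoef \<alpha> (Suc (Suc n))"
proof -
  have "(powr_increment \<alpha> (real (Suc n)))\<^sup>2 / (Gamma (1 + \<alpha>))\<^sup>2
      \<le> powr_increment \<alpha> (real n) * powr_increment \<alpha> (real (Suc (Suc n))) / (Gamma (1 + \<alpha>))\<^sup>2"
    using powr_increment_log_convex[OF assms, of "real n"]
    by (intro divide_right_mono) (simp_all add: add_ac)
  then show ?thesis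
    by (simp only: acoef_eq_powr_increment power_divide times_divide_times_eq power2_eq_square)
qed

lemma acoef_decseq:
  assumes "0 < \<alpha>" "\<alpha> < 1"
  shows "decseq (acoef \<alpha>)"
proof (rule decseq_SucI)
  fix n
  have "powr_increment \<alpha> (real n + 1) < powr_increment \<alpha> (real n)"
  \<comment> \<open>The derivative is taken only inside the interval, since for \<open>n = 0\<close>
    the left end point is singular for \<open>x powr \<alpha>\<close>.\<close>
  proof (rule DERIV_neg_imp_decreasing_open[of "real n" "real n + 1" "powr_increment \<alpha>"])
    show "continuous_on {real n..real n + 1} (powr_increment \<alpha>)"
      using continuous_on_powr_increment[OF assms(1)] by (rule continuous_on_subset) auto
    fix x assume "real n < x" "x < real n + 1"
    then have x: "x > 0" by (simp add: order.strict_trans1[OF of_nat_0_le_iff])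
    have "powr_increment (\<alpha> - 1) x < 0"
      using x assms by (simp add: powr_increment_def powr_less_mono2_neg)
    then show "\<exists>y. (powr_increment \<alpha> has_real_derivative y) (at x) \<and> y < 0"
      using powr_increment_has_real_derivative[OF x, of \<alpha>] assms(1) by (auto simp: mult_pos_neg)
  qed simp
  then show "acoef \<alpha> (Suc n) \<le> acoef \<alpha> n"
    using assms by (simp add: acoef_eq_powr_increment divide_right_mono Gamma_real_pos less_imp_le add.commute)
qed

section \<open>Nonnegative coefficients and the difference form of the Caputo derivative\<close>

lemma ccoef_nonneg:
  assumes "0 < \<alpha>" "\<alpha> < 1"
  shows "ccoef \<alpha> i \<ge> 0"
proof (cases "i = 0")
  case True
  then show ?thesis using assms by (simp add: ccoef_0(1) Gamma_real_pos less_imp_le)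
next
  case False
  then show ?thesis
    using Kaluza[of "acoef \<alpha>" i] acoef_pos acoef_log_convex assms by (simp add: ccoef_def)
qed

lemma ccoef_diag_nonneg:
  assumes "0 < \<alpha>" "\<alpha> < 1"
  shows "ccoef_diag \<alpha> n \<ge> 0"
proof -
  have "(\<Sum>i=1..n-1. ccoef \<alpha> i) = (\<Sum>i=1..n-1. - conv_inverse (acoef \<alpha>) i)"
    by (rule sum.cong) (auto simp: ccoef_def)
  then show ?thesis
    using conv_inverse_partial_sum_nonneg[OF acoef_pos acoef_log_convex acoef_decseq, OF assms(1) assms assms]
    by (simp add: ccoef_diag_def ccoef_def[of \<alpha> 0])
qed

text \<open>By the choice of \<open>ccoef_diag\<close>, the coefficient of \<open>X n\<close> is the
  sum of all the subtracted ones, so each history term is paired with its own copy of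
  \<open>X n\<close>.\<close>

lemma caputo_differences:
  "caputo \<alpha> k X n = k powr (-\<alpha>) *\<^sub>R
     ((\<Sum>i=1..n-1. ccoef \<alpha> i *\<^sub>R (X n - X (n - i))) + ccoef_diag \<alpha> n *\<^sub>R (X n - X 0))"
  unfolding caputo_def ccoef_diag_def
  by (simp only: scaleR_right_diff_distrib scaleR_left_diff_distrib sum_subtractf scaleR_left.sum)
    (simp add: algebra_simps)

lemma caputo_diff: "caputo \<alpha> k (\<lambda>n. X n - Y n) n = caputo \<alpha> k X n - caputo \<alpha> k Y n"
  unfolding caputo_def by (simp add: scaleR_diff_right sum_subtractf)

section \<open>Convexity inequality\<close>

text \<open>Restriction to the line through \<open>x\<close> and \<open>y\<close> reduces this to
  the tangent inequality for a convex function of one real variable.\<close>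

lemma convex_on_above_gradient:
  fixes E :: "'a::euclidean_space \<Rightarrow> real"
  assumes "convex_on UNIV E" "E differentiable (at x)"
  shows "E x - E y \<le> (x - y) \<bullet> grad E x"
proof -
  let ?\<phi> = "\<lambda>t::real. E (x + t *\<^sub>R (y - x))"
  have "convex_on UNIV ?\<phi>"
  proof (rule convex_onI)
    fix t a b :: real
    assume "0 < t" "t < 1"
    have "x + ((1 - t) *\<^sub>R a + t *\<^sub>R b) *\<^sub>R (y - x)
        = (1 - t) *\<^sub>R (x + a *\<^sub>R (y - x)) + t *\<^sub>R (x + b *\<^sub>R (y - x))"
      by (simp add: algebra_simps)
    then show "?\<phi> ((1 - t) *\<^sub>R a + t *\<^sub>R b) \<le> (1 - t) * ?\<phi> a + t * ?\<phi> b"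
      using convex_onD[OF assms(1), of t] \<open>0 < t\<close> \<open>t < 1\<close> by simp
  qed simp
  moreover have "(?\<phi> has_real_derivative (y - x) \<bullet> grad E x) (at 0)"
  proof -
    have "(E has_derivative (\<lambda>h. h \<bullet> grad E x)) (at (x + 0 *\<^sub>R (y - x)))"
      using GDERIV_grad[OF assms(2)] by (simp add: gderiv_def)
    moreover have "((\<lambda>t. x + t *\<^sub>R (y - x)) has_derivative (\<lambda>t. t *\<^sub>R (y - x))) (at 0)"
      by (auto intro!: derivative_eq_intros)
    ultimately have "(?\<phi> has_derivative (\<lambda>t. (t *\<^sub>R (y - x)) \<bullet> grad E x)) (at 0)"
      by (rule has_derivative_compose[rotated])
    then show ?thesis
      by (simp add: has_field_derivative_def mult_commute_abs)
  qed
  \<comment> \<open>The tangent at \<open>t = 0\<close> is compared with the value at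
    \<open>t = 1\<close>, that is, at \<open>y\<close>.\<close>
  ultimately have "?\<phi> 1 - ?\<phi> 0 \<ge> (y - x) \<bullet> grad E x * (1 - 0)"
    by (intro convex_on_imp_above_tangent[of UNIV]) auto
  then show ?thesis by (simp add: inner_diff_left)
qed

lemma caputo_convex:
  fixes E :: "'a::euclidean_space \<Rightarrow> real"
  assumes "0 < \<alpha>" "\<alpha> < 1" "convex_on UNIV E" "E differentiable (at (X n))"
  shows "caputo \<alpha> k (\<lambda>m. E (X m)) n \<le> caputo \<alpha> k X n \<bullet> grad E (X n)"
  unfolding caputo_differences inner_scaleR_left inner_add_left inner_sum_left real_scaleR_def
  by (intro mult_left_mono add_mono sum_mono convex_on_above_gradient
      ccoef_nonneg ccoef_diag_nonneg assms) auto

section \<open>Comparison for the Caputo form\<close>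

text \<open>Common core of both Caputo comparisons, applied to \<open>u - v\<close>. At the first
  positive index the history and initial terms can only raise the derivative above the diagonal
  term, which \<open>sub\<close> forbids.\<close>

lemma caputo_maximum_principle:
  fixes d :: "nat \<Rightarrow> real"
  assumes "0 < \<alpha>" "\<alpha> < 1" "d 0 \<le> 0"
    and sub: "\<And>n. n \<ge> 1 \<Longrightarrow> d n > 0 \<Longrightarrow> caputo \<alpha> k d n < k powr (-\<alpha>) * ccoef \<alpha> 0 * d n"
  shows "d n \<le> 0"
proof (induction n rule: less_induct)
  case (less n)
  show ?case
  proof (rule ccontr)
    assume "\<not> d n \<le> 0"
    then have pos: "d n > 0" "n \<ge> 1" using assms(3) by (auto intro: Suc_leI gr0I)
    have "(\<Sum>i=1..n-1. ccoef \<alpha> i * d (n - i)) \<le> 0"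
      by (intro sum_nonpos mult_nonneg_nonpos ccoef_nonneg assms less.IH) auto
    moreover have "ccoef_diag \<alpha> n * d 0 \<le> 0"
      by (intro mult_nonneg_nonpos ccoef_diag_nonneg assms)
    ultimately have "k powr (-\<alpha>) * (ccoef \<alpha> 0 * d n) \<le> caputo \<alpha> k d n"
      unfolding caputo_def real_scaleR_def by (intro mult_left_mono) auto
    with sub[of n] pos show False by simp
  qed
qed

text \<open>Where \<open>u\<close> exceeds \<open>v\<close>, the monotonicity of \<open>f\<close>
  makes the derivative of the difference nonpositive, hence below the positive diagonal
  term.\<close>

lemma caputo_comparison_antimono:
  fixes u v :: "nat \<Rightarrow> real"
  assumes "0 < \<alpha>" "\<alpha> < 1" "0 < k" "u 0 \<le> v 0"
    and f: "\<And>s. s \<ge> 0 \<Longrightarrow> antimono (f s)"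
    and u: "\<And>n. n \<ge> 1 \<Longrightarrow> caputo \<alpha> k u n \<le> f (real n * k) (u n)"
    and v: "\<And>n. n \<ge> 1 \<Longrightarrow> caputo \<alpha> k v n \<ge> f (real n * k) (v n)"
  shows "u n \<le> v n"
proof -
  have "u n - v n \<le> 0"
  proof (rule caputo_maximum_principle[where k = k, OF assms(1,2)])
    fix m :: nat assume m: "m \<ge> 1" "u m - v m > 0"
    have "f (real m * k) (u m) \<le> f (real m * k) (v m)"
      using f[of "real m * k"] m assms(3) by (auto intro: antimonoD)
    then have "caputo \<alpha> k (\<lambda>i. u i - v i) m \<le> 0"
      unfolding caputo_diff using u[OF m(1)] v[OF m(1)] by linarith
    also have "0 < k powr (-\<alpha>) * ccoef \<alpha> 0 * (u m - v m)"
      using m assms by (simp add: ccoef_0(1) Gamma_real_pos)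
    finally show "caputo \<alpha> k (\<lambda>i. u i - v i) m < k powr (-\<alpha>) * ccoef \<alpha> 0 * (u m - v m)" .
  qed (use assms(4) in simp)
  then show ?thesis by simp
qed

lemma lipschitz_on_increment_le:
  fixes g :: "real \<Rightarrow> real"
  assumes "L-lipschitz_on UNIV g" "y \<le> x"
  shows "g x - g y \<le> L * (x - y)"
  using lipschitz_onD[OF assms(1), of x y] assms(2) by (simp add: dist_real_def)

text \<open>Where \<open>u\<close> exceeds \<open>v\<close>, the derivative of the difference is at
  most \<open>L\<close> times the difference, and \<open>step\<close> puts \<open>L\<close> strictly
  below the diagonal coefficient \<open>k powr (-\<alpha>) * ccoef \<alpha> 0\<close>.\<close>

lemma caputo_comparison_lipschitz:
  fixes u v :: "nat \<Rightarrow> real"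
  assumes "0 < \<alpha>" "\<alpha> < 1" "0 < k" "u 0 \<le> v 0"
    and f: "\<And>s. s \<ge> 0 \<Longrightarrow> L-lipschitz_on UNIV (f s)"
    and u: "\<And>n. n \<ge> 1 \<Longrightarrow> caputo \<alpha> k u n \<le> f (real n * k) (u n)"
    and v: "\<And>n. n \<ge> 1 \<Longrightarrow> caputo \<alpha> k v n \<ge> f (real n * k) (v n)"
    and step: "k powr \<alpha> * L < ccoef \<alpha> 0"
  shows "u n \<le> v n"
proof -
  have "u n - v n \<le> 0"
  proof (rule caputo_maximum_principle[where k = k, OF assms(1,2)])
    fix m :: nat assume m: "m \<ge> 1" "u m - v m > 0"
    have "f (real m * k) (u m) - f (real m * k) (v m) \<le> L * (u m - v m)"
      using m assms(3) by (intro lipschitz_on_increment_le f) auto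
    then have "caputo \<alpha> k (\<lambda>i. u i - v i) m \<le> L * (u m - v m)"
      unfolding caputo_diff using u[OF m(1)] v[OF m(1)] by linarith
    also have "L < k powr (-\<alpha>) * ccoef \<alpha> 0"
      using step assms(3) by (simp add: powr_minus field_simps)
    then have "L * (u m - v m) < k powr (-\<alpha>) * ccoef \<alpha> 0 * (u m - v m)"
      using m(2) by (rule mult_strict_right_mono)
    finally show "caputo \<alpha> k (\<lambda>i. u i - v i) m < k powr (-\<alpha>) * ccoef \<alpha> 0 * (u m - v m)" .
  qed (use assms(4) in simp)
  then show ?thesis by simp
qed

section \<open>Comparison for the integral form\<close>

text \<open>At the first index where \<open>u\<close> exceeds \<open>v\<close>, monotone
  \<open>f\<close> and positive weights make the earlier contributions nonpositive; the Lipschitz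
  bound and \<open>step\<close> keep the current one strictly below
  \<open>u n - v n\<close>.\<close>

lemma frac_integral_comparison:
  fixes u v :: "nat \<Rightarrow> real"
  assumes "0 < \<alpha>" "0 < k" "u 0 \<le> v 0"
    and mono: "\<And>s. s \<ge> 0 \<Longrightarrow> mono (f s)"
    and lip: "\<And>s. s \<ge> 0 \<Longrightarrow> L-lipschitz_on UNIV (f s)"
    and u: "\<And>n. n \<ge> 1 \<Longrightarrow> u n \<le> u 0 + frac_integral \<alpha> k (rhs_seq f k u) n"
    and v: "\<And>n. n \<ge> 1 \<Longrightarrow> v n \<ge> v 0 + frac_integral \<alpha> k (rhs_seq f k v) n"
    and step: "k powr \<alpha> * acoef \<alpha> 0 * L < 1"
  shows "u n \<le> v n"
proof (induction n rule: less_induct)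
  case (less n)
  show ?case
  proof (rule ccontr)
    assume "\<not> u n \<le> v n"
    then have pos: "u n - v n > 0" and n: "n \<ge> 1"
      using assms(3) by (auto intro: Suc_leI gr0I)
    define g where "g m = f (real m * k) (u m) - f (real m * k) (v m)" for m
    \<comment> \<open>At index \<open>0\<close> both \<open>rhs_seq\<close> values are
      \<open>0\<close> while \<open>g 0\<close> need not vanish; the sums start at
      \<open>1\<close>.\<close>
    have g: "rhs_seq f k u m - rhs_seq f k v m = g m" if "m \<ge> 1" for m
      using that by (simp add: rhs_seq_def g_def)
    have "u n - v n \<le> frac_integral \<alpha> k (rhs_seq f k u) n - frac_integral \<alpha> k (rhs_seq f k v) n"
      using u[OF n] v[OF n] assms(3) by linarith
    also have "\<dots> = k powr \<alpha> * (\<Sum>m=1..n. acoef \<alpha> (n - m) * g m)"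
      unfolding frac_integral_def right_diff_distrib[symmetric] sum_subtractf[symmetric]
      using g by (intro arg_cong2[where f = "(*)"] sum.cong refl) auto
    \<comment> \<open>Only the current term \<open>m = n\<close> can be positive, so it is split
      off.\<close>
    also have "(\<Sum>m=1..n. acoef \<alpha> (n - m) * g m)
        = acoef \<alpha> 0 * g n + (\<Sum>m=1..n-1. acoef \<alpha> (n - m) * g m)"
      using n by (cases n) auto
    also have "\<dots> \<le> acoef \<alpha> 0 * (L * (u n - v n)) + 0"
    proof (intro add_mono mult_left_mono sum_nonpos mult_nonneg_nonpos)
      show "g n \<le> L * (u n - v n)"
        unfolding g_def using pos assms(2) by (intro lipschitz_on_increment_le lip) auto
      fix m assume "m \<in> {1..n-1}"
      then have "u m \<le> v m" using n by (intro less.IH) auto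
      then show "g m \<le> 0"
        unfolding g_def using monoD[OF mono, of "real m * k"] assms(2) by simp
    qed (use acoef_pos[OF assms(1)] in \<open>auto simp: less_imp_le\<close>)
    finally have "u n - v n \<le> k powr \<alpha> * acoef \<alpha> 0 * L * (u n - v n)"
      by (simp add: mult_left_mono mult.assoc)
    also have "\<dots> < 1 * (u n - v n)"
      using step pos by (rule mult_strict_right_mono)
    finally show False by simp
  qed
qed

theorem theorem3p1:
  fixes \<alpha> k :: real
    and u v w :: "nat \<Rightarrow> real"
    and f :: "real \<Rightarrow> real \<Rightarrow> real"
  assumes "0 < \<alpha>" "\<alpha> < 1"
    and "0 < k"
    and "u 0 \<le> v 0" "v 0 \<le> w 0"
  shows
    "(\<forall>(E :: real ^ 'd \<Rightarrow> real) (X :: nat \<Rightarrow> real ^ 'd).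
        convex_on UNIV E \<longrightarrow> (\<forall>x. E differentiable (at x)) \<longrightarrow>
        (\<forall>n\<ge>1. caputo \<alpha> k (\<lambda>m. E (X m)) n \<le> caputo \<alpha> k X n \<bullet> grad E (X n)))
   \<and> ((\<forall>s\<ge>0. antimono (f s)) \<longrightarrow>
        (\<forall>n\<ge>1. caputo \<alpha> k u n \<le> f (real n * k) (u n)) \<longrightarrow>
        (\<forall>n\<ge>1. caputo \<alpha> k v n = f (real n * k) (v n)) \<longrightarrow>
        (\<forall>n\<ge>1. caputo \<alpha> k w n \<ge> f (real n * k) (w n)) \<longrightarrow>
        (\<forall>n. u n \<le> v n \<and> v n \<le> w n))
   \<and> (\<forall>L. (\<forall>s\<ge>0. L-lipschitz_on UNIV (f s)) \<longrightarrow>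
        (\<forall>n\<ge>1. caputo \<alpha> k u n \<le> f (real n * k) (u n)) \<longrightarrow>
        (\<forall>n\<ge>1. caputo \<alpha> k v n = f (real n * k) (v n)) \<longrightarrow>
        (\<forall>n\<ge>1. caputo \<alpha> k w n \<ge> f (real n * k) (w n)) \<longrightarrow>
        ccoef \<alpha> 0 > k powr \<alpha> * L \<longrightarrow>
        (\<forall>n. u n \<le> v n \<and> v n \<le> w n))
   \<and> (\<forall>L. (\<forall>s\<ge>0. mono (f s)) \<longrightarrow>
        (\<forall>s\<ge>0. L-lipschitz_on UNIV (f s)) \<longrightarrow>
        (\<forall>n\<ge>1. u n \<le> u 0 + frac_integral \<alpha> k (rhs_seq f k u) n) \<longrightarrow>
        (\<forall>n\<ge>1. v n = v 0 + frac_integral \<alpha> k (rhs_seq f k v) n) \<longrightarrow>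
        (\<forall>n\<ge>1. w n \<ge> w 0 + frac_integral \<alpha> k (rhs_seq f k w) n) \<longrightarrow>
        k powr \<alpha> * acoef \<alpha> 0 * L < 1 \<longrightarrow>
        (\<forall>n. u n \<le> v n \<and> v n \<le> w n))"
proof (intro conjI allI impI, goal_cases)
  case (1 E X n)
  then show ?case using assms by (intro caputo_convex) auto
next
  \<comment> \<open>In each comparison the equation for \<open>v\<close> is used as
    \<open>\<ge>\<close> against \<open>u\<close> and as \<open>\<le>\<close> against
    \<open>w\<close>.\<close>
  case (2 n)
  show ?case by (rule caputo_comparison_antimono[of \<alpha> k u v f]) (use 2 assms in auto)
next
  case (3 n)
  show ?case by (rule caputo_comparison_antimono[of \<alpha> k v w f]) (use 3 assms in auto)
next
  case (4 L n)
  show ?case by (rule caputo_comparison_lipschitz[of \<alpha> k u v L f]) (use 4 assms in auto)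
next
  case (5 L n)
  show ?case by (rule caputo_comparison_lipschitz[of \<alpha> k v w L f]) (use 5 assms in auto)
next
  case (6 L n)
  show ?case by (rule frac_integral_comparison[of \<alpha> k u v f L]) (use 6 assms in auto)
next
  case (7 L n)
  show ?case by (rule frac_integral_comparison[of \<alpha> k v w f L]) (use 7 assms in auto)
qed

end
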